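(* Let $\sigma\in S_n$ satisfy $\sigma(1)=1$ and $\sigma(n)=n$, and let the strong fixed points of $\sigma$ be $1=i_0<i_1<\cdots<i_{k+1}=n$. Then there are exactly $(i_1+1)(i_2+1)\cdots(i_k+1)$ connected permutations $\pi\in S_n$ whose elevation $E(\pi)$ equals $\sigma$.
   Context: The place-based non-inversion table (PNT) of $\pi\in S_n$ is the word $v_1\cdots v_n$ with $v_j=1+|\{i<j:\pi(i)<\pi(j)\}|$; it satisfies $1\le v_j\le j$, and every such word is the PNT of exactly one permutation. A permutation $\pi\in S_n$ is connected if there is no $m<n$ with $\pi(\{1,\ldots,m\})=\{1,\ldots,m\}$. For $2\le i\le j$, an elementary kernel factor of type $(i,j)$ is a word $v_i\cdots v_j$ with $i\le v_i,\ldots,v_{j-1}$ and $v_j<i$. If $\pi$ is connected with PNT $v_1\cdots v_n$, then $v_1=1$ and $v_2\cdots v_n$ can be written uniquely as a concatenation of elementary kernel factors of types $(j_0+1,j_1),(j_1+1,j_2),\ldots,(j_l+1,j_{l+1})$ with $1=j_0<j_1<\cdots<j_{l+1}=n$. The elevation $E(\pi)$ is the permutation whose PNT is obtained from the PNT of $\pi$ by increasing, for each such elementary kernel factor of type $(i,j)$, its last letter $v_j$ to $j$. A number $i$ is a strong fixed point of $\sigma$ if $\sigma(i)=i$ and $\sigma(\{1,\ldots,i\})=\{1,\ldots,i\}$. *)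

theory Defs
  imports Complex_Main "HOL-Combinatorics.Permutations"
begin

text \<open>
  An element of \<open>S\<^sub>n\<close> is a function \<open>\<pi> :: nat \<Rightarrow> nat\<close> with \<open>\<pi> permutes {1..n}\<close>. A word
  \<open>v\<^sub>1 \<cdots> v\<^sub>n\<close> is a function \<open>v :: nat \<Rightarrow> nat\<close> of which only the values on \<open>{1..n}\<close> matter.
\<close>

definition pnt :: "(nat \<Rightarrow> nat) \<Rightarrow> nat \<Rightarrow> nat" where
  "pnt \<pi> j = 1 + card {i \<in> {1..<j}. \<pi> i < \<pi> j}"

definition connected_perm :: "nat \<Rightarrow> (nat \<Rightarrow> nat) \<Rightarrow> bool" where
  "connected_perm n \<pi> \<longleftrightarrow> \<not> (\<exists>m. 1 \<le> m \<and> m < n \<and> \<pi> ` {1..m} = {1..m})"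

text \<open>The factor \<open>v\<^sub>i \<cdots> v\<^sub>j\<close> of the word \<open>v\<close> is an elementary kernel factor of type \<open>(i,j)\<close>.\<close>

definition elementary_kernel_factor :: "(nat \<Rightarrow> nat) \<Rightarrow> nat \<Rightarrow> nat \<Rightarrow> bool" where
  "elementary_kernel_factor v i j \<longleftrightarrow>
     2 \<le> i \<and> i \<le> j \<and> (\<forall>m\<in>{i..<j}. i \<le> v m) \<and> v j < i"

text \<open>
  The list \<open>js = [j\<^sub>0, \<dots>, j\<^bsub>l+1\<^esub>]\<close> with \<open>1 = j\<^sub>0 < \<cdots> < j\<^bsub>l+1\<^esub> = n\<close> cuts \<open>v\<^sub>2 \<cdots> v\<^sub>n\<close> into elementary
  kernel factors of types \<open>(j\<^sub>t + 1, j\<^bsub>t+1\<^esub>)\<close>.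
\<close>

definition kernel_factorization :: "nat \<Rightarrow> (nat \<Rightarrow> nat) \<Rightarrow> nat list \<Rightarrow> bool" where
  "kernel_factorization n v js \<longleftrightarrow>
     js \<noteq> [] \<and> hd js = 1 \<and> last js = n \<and> sorted_wrt (<) js \<and>
     successively (\<lambda>a b. elementary_kernel_factor v (a + 1) b) js"

text \<open>
  The last positions \<open>j\<^sub>1, \<dots>, j\<^bsub>l+1\<^esub>\<close> of the factors form the tail of the list of cuts.
  Meaningful for connected \<open>\<pi>\<close>, where the factorization exists and is unique.
\<close>

definition elevated_pnt :: "nat \<Rightarrow> (nat \<Rightarrow> nat) \<Rightarrow> nat \<Rightarrow> nat" where
  "elevated_pnt n \<pi> j =
     (if j \<in> set (tl (THE js. kernel_factorization n (pnt \<pi>) js)) then j else pnt \<pi> j)"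

definition elevation :: "nat \<Rightarrow> (nat \<Rightarrow> nat) \<Rightarrow> nat \<Rightarrow> nat" where
  "elevation n \<pi> =
     (THE \<sigma>. \<sigma> permutes {1..n} \<and> (\<forall>j\<in>{1..n}. pnt \<sigma> j = elevated_pnt n \<pi> j))"

definition strong_fixed_point :: "(nat \<Rightarrow> nat) \<Rightarrow> nat \<Rightarrow> bool" where
  "strong_fixed_point \<sigma> i \<longleftrightarrow> \<sigma> i = i \<and> \<sigma> ` {1..i} = {1..i}"

end

theory Submission
  imports Defs
begin

text \<open>
  Everything is read off from the PNT \<open>w\<close> of \<open>\<sigma>\<close>. Since \<open>\<pi>\<close> maps \<open>{1..m}\<close> to itself iff all letters
  of its PNT after position \<open>m\<close> exceed \<open>m\<close>, a word belongs to a connected permutation iff the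
  greedy factorization into elementary kernel factors ends exactly at \<open>n\<close>, and the cuts of a word
  with elevation \<open>w\<close> are strong fixed points of \<open>\<sigma>\<close>. Conversely, given any set \<open>S\<close> of strong fixed
  points strictly between 1 and \<open>n\<close>, the words with elevation \<open>w\<close> and inner cuts \<open>S\<close> arise by
  replacing the letter at each \<open>j \<in> S \<union> {n}\<close> by an arbitrary letter between 1 and the element of
  \<open>S \<union> {1}\<close> preceding \<open>j\<close>. There are \<open>\<Prod>S\<close> of them, and summing over \<open>S\<close> gives the product of
  the numbers \<open>i\<^sub>t + 1\<close>.
\<close>

section \<open>Permutations and their tables\<close>

lemma pnt_range:
  assumes "1 \<le> j"
  shows "pnt \<pi> j \<in> {1..j}"
proof -
  have "card {i \<in> {1..<j}. \<pi> i < \<pi> j} \<le> card {1..<j}"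
    by (intro card_mono) auto
  then show ?thesis using assms by (simp add: pnt_def)
qed

lemma card_eq_comparable_imp_eq:
  assumes "finite A" "finite B" "card A = card B" "A \<subseteq> B \<or> B \<subseteq> A"
  shows "A = B"
  using assms card_subset_eq by metis

text \<open>Induction on the length of the prefix. The earlier positions with a value below that of
  the new one form a down-set in the common order of the prefix. Two down-sets of a linear order are
  comparable, so equal letters force them to coincide.\<close>

lemma pnt_eq_imp_same_order:
  assumes eq: "\<And>j. j \<in> {1..n} \<Longrightarrow> pnt \<pi> j = pnt \<rho> j"
    and inj: "inj_on \<pi> {1..n}" "inj_on \<rho> {1..n}"
    and "a \<in> {1..n}" "b \<in> {1..n}"
  shows "\<pi> a < \<pi> b \<longleftrightarrow> \<rho> a < \<rho> b"
proof -
  have "\<forall>a\<in>{1..m}. \<forall>b\<in>{1..m}. \<pi> a < \<pi> b \<longleftrightarrow> \<rho> a < \<rho> b" if "m \<le> n" for m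
    using that
  proof (induction m)
    case (Suc m)
    let ?A = "{i \<in> {1..m}. \<pi> i < \<pi> (Suc m)}"
    let ?B = "{i \<in> {1..m}. \<rho> i < \<rho> (Suc m)}"
    have IH: "\<pi> a < \<pi> b \<longleftrightarrow> \<rho> a < \<rho> b" if "a \<in> {1..m}" "b \<in> {1..m}" for a b
      using Suc that by auto
    have "card ?A = card ?B"
      using eq[of "Suc m"] Suc.prems by (simp add: pnt_def atLeastLessThanSuc_atLeastAtMost)
    moreover have "?A \<subseteq> ?B \<or> ?B \<subseteq> ?A"
    proof (rule ccontr)
      assume "\<not> ?thesis"
      then obtain x y where x: "x \<in> {1..m}" "\<pi> x < \<pi> (Suc m)" "\<not> \<rho> x < \<rho> (Suc m)"
        and y: "y \<in> {1..m}" "\<not> \<pi> y < \<pi> (Suc m)" "\<rho> y < \<rho> (Suc m)"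
        by blast
      from x y have "\<pi> x < \<pi> y" "\<rho> y < \<rho> x" by linarith+
      with IH[of x y] x y show False by simp
    qed
    ultimately have AB: "?A = ?B" by (intro card_eq_comparable_imp_eq) auto
    have new: "\<pi> i < \<pi> (Suc m) \<longleftrightarrow> \<rho> i < \<rho> (Suc m)" if "i \<in> {1..m}" for i
      using AB that by blast
    have ne: "\<pi> i \<noteq> \<pi> (Suc m)" "\<rho> i \<noteq> \<rho> (Suc m)" if "i \<in> {1..m}" for i
      using that Suc.prems inj by (auto dest: inj_onD)
    have new': "\<pi> (Suc m) < \<pi> i \<longleftrightarrow> \<rho> (Suc m) < \<rho> i" if "i \<in> {1..m}" for i
      using new[OF that] ne[OF that] by linarith
    have "{1..Suc m} = insert (Suc m) {1..m}" by auto
    then show ?case using IH new new' by auto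
  qed simp
  then show ?thesis using assms by blast
qed

text \<open>A value in \<open>{1..n}\<close> equals its rank, so the relative order of the values
  determines the permutation.\<close>

lemma permutes_eq_card_le:
  assumes "\<pi> permutes {1..n}" "a \<in> {1..n}"
  shows "\<pi> a = card {b \<in> {1..n}. \<pi> b \<le> \<pi> a}"
proof -
  have "\<pi> ` {b \<in> {1..n}. \<pi> b \<le> \<pi> a} = {y \<in> \<pi> ` {1..n}. y \<le> \<pi> a}" by auto
  also have "\<dots> = {1..\<pi> a}"
    using assms permutes_in_image[of \<pi> "{1..n}" a] by (auto simp: permutes_image)
  finally have "card {1..\<pi> a} = card (\<pi> ` {b \<in> {1..n}. \<pi> b \<le> \<pi> a})" by simp
  also have "\<dots> = card {b \<in> {1..n}. \<pi> b \<le> \<pi> a}"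
    by (intro card_image inj_on_subset[OF permutes_inj_on[OF assms(1)]]) auto
  finally show ?thesis by simp
qed

lemma pnt_inject:
  assumes "\<pi> permutes {1..n}" "\<rho> permutes {1..n}"
    and "\<And>j. j \<in> {1..n} \<Longrightarrow> pnt \<pi> j = pnt \<rho> j"
  shows "\<pi> = \<rho>"
proof
  fix a
  show "\<pi> a = \<rho> a"
  proof (cases "a \<in> {1..n}")
    case True
    have inj: "inj_on \<pi> {1..n}" "inj_on \<rho> {1..n}" using assms permutes_inj_on by blast+
    have "\<pi> b \<le> \<pi> a \<longleftrightarrow> \<rho> b \<le> \<rho> a" if "b \<in> {1..n}" for b
      using pnt_eq_imp_same_order[OF assms(3) inj True that] by (simp add: linorder_not_less[symmetric])
    then have "{b \<in> {1..n}. \<pi> b \<le> \<pi> a} = {b \<in> {1..n}. \<rho> b \<le> \<rho> a}" by blast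
    then show ?thesis using permutes_eq_card_le[OF assms(1) True] permutes_eq_card_le[OF assms(2) True]
      by simp
  next
    case False
    then show ?thesis using assms by (simp add: permutes_not_in)
  qed
qed

text \<open>Surjectivity is obtained by counting: both sides have \<open>fact n\<close> elements.
  Restricting the tables makes equal words equal functions.\<close>

lemma bij_betw_pnt:
  "bij_betw (\<lambda>\<pi>. restrict (pnt \<pi>) {1..n}) {\<pi>. \<pi> permutes {1..n}} (\<Pi>\<^sub>E j\<in>{1..n}. {1..j})"
  (is "bij_betw ?f ?P ?W")
proof -
  have inj: "inj_on ?f ?P"
  proof (rule inj_onI)
    fix \<pi> \<rho> assume "\<pi> \<in> ?P" "\<rho> \<in> ?P" and eq: "?f \<pi> = ?f \<rho>"
    moreover have "pnt \<pi> j = pnt \<rho> j" if "j \<in> {1..n}" for j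
      using fun_cong[OF eq, of j] that by simp
    ultimately show "\<pi> = \<rho>" by (intro pnt_inject) auto
  qed
  have sub: "?f ` ?P \<subseteq> ?W" using pnt_range by auto
  have "card (?f ` ?P) = card ?P" by (rule card_image[OF inj])
  also have "\<dots> = fact n" by (rule card_permutations) simp_all
  also have "\<dots> = card ?W" by (simp add: card_PiE fact_prod)
  finally have "card (?f ` ?P) = card ?W" .
  then have "?f ` ?P = ?W" using sub by (intro card_subset_eq finite_PiE) auto
  with inj show ?thesis by (simp add: bij_betw_def)
qed

lemma ex1_permutes_pnt:
  assumes "\<And>j. j \<in> {1..n} \<Longrightarrow> v j \<in> {1..j}"
  shows "\<exists>!\<sigma>. \<sigma> permutes {1..n} \<and> (\<forall>j\<in>{1..n}. pnt \<sigma> j = v j)"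
proof -
  have "restrict v {1..n} \<in> (\<Pi>\<^sub>E j\<in>{1..n}. {1..j})" using assms by auto
  then obtain \<sigma> where \<sigma>: "\<sigma> permutes {1..n}" and eq: "restrict v {1..n} = restrict (pnt \<sigma>) {1..n}"
    using bij_betw_imp_surj_on[OF bij_betw_pnt[of n]] by blast
  have "pnt \<sigma> j = v j" if "j \<in> {1..n}" for j using fun_cong[OF eq, of j] that by simp
  then show ?thesis using \<sigma> by (intro ex1I[of _ \<sigma>]) (auto intro!: pnt_inject)
qed

section \<open>Invariant initial segments and strong fixed points\<close>

lemma image_initial_segment_iff_pnt:
  assumes \<pi>: "\<pi> permutes {1..n}" and "m \<le> n"
  shows "\<pi> ` {1..m} = {1..m} \<longleftrightarrow> (\<forall>j\<in>{m<..n}. m < pnt \<pi> j)"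
proof
  assume im: "\<pi> ` {1..m} = {1..m}"
  show "\<forall>j\<in>{m<..n}. m < pnt \<pi> j"
  proof
    fix j assume j: "j \<in> {m<..n}"
    have "\<pi> j \<in> {1..n}" using permutes_in_image[OF \<pi>, of j] j by simp
    moreover have "\<pi> j \<notin> {1..m}"
      using j im inj_image_mem_iff[OF permutes_inj[OF \<pi>], of j "{1..m}"] by simp
    ultimately have "m < \<pi> j" by auto
    moreover have "\<pi> i \<le> m" if "i \<in> {1..m}" for i using im that by force
    ultimately have "{1..m} \<subseteq> {i \<in> {1..<j}. \<pi> i < \<pi> j}" using j by force
    then have "card {1..m} \<le> card {i \<in> {1..<j}. \<pi> i < \<pi> j}" by (intro card_mono) auto
    then show "m < pnt \<pi> j" by (simp add: pnt_def)
  qed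
next
  assume big: "\<forall>j\<in>{m<..n}. m < pnt \<pi> j"
  \<comment> \<open>By strong induction, large letters after \<open>m\<close> force large values: if
    some \<open>i\<close> in \<open>{1..m}\<close> had a value at least \<open>\<pi> j\<close>, then
    neither \<open>i\<close> nor any position between \<open>m\<close> and \<open>j\<close> would be
    counted at \<open>j\<close>, leaving at most \<open>m - 1\<close> positions.\<close>
  have less: "\<forall>i\<in>{1..m}. \<pi> i < \<pi> j" if "j \<in> {m<..n}" for j
    using that
  proof (induction j rule: less_induct)
    case (less j)
    show ?case
    proof (rule ccontr)
      assume "\<not> ?case"
      then obtain i where i: "i \<in> {1..m}" "\<pi> j \<le> \<pi> i" by (auto simp: not_less)
      have "{x \<in> {1..<j}. \<pi> x < \<pi> j} \<subseteq> {1..m} - {i}"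
      proof
        fix x assume x: "x \<in> {x \<in> {1..<j}. \<pi> x < \<pi> j}"
        have "\<not> m < x"
        proof
          assume "m < x"
          then have "\<pi> i < \<pi> x" using less.IH[of x] less.prems i x by auto
          then show False using i x by auto
        qed
        then show "x \<in> {1..m} - {i}" using x i by auto
      qed
      then have "card {x \<in> {1..<j}. \<pi> x < \<pi> j} \<le> card ({1..m} - {i})"
        by (intro card_mono) auto
      also have "\<dots> = m - 1" using i by simp
      finally have "pnt \<pi> j \<le> m" using i unfolding pnt_def by auto
      then show False using big less.prems by force
    qed
  qed
  have "\<pi> ` {1..m} \<subseteq> {1..m}"
  proof
    fix y assume "y \<in> \<pi> ` {1..m}"
    then obtain i where i: "i \<in> {1..m}" "y = \<pi> i" by blast
    \<comment> \<open>All values after \<open>m\<close> are larger than \<open>\<pi> i\<close>, so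
      its rank is at most \<open>m\<close>.\<close>
    have "{b \<in> {1..n}. \<pi> b \<le> \<pi> i} \<subseteq> {1..m}"
      using less i by (force simp: not_le[symmetric])
    then have "card {b \<in> {1..n}. \<pi> b \<le> \<pi> i} \<le> card {1..m}" by (intro card_mono) auto
    moreover have "\<pi> i \<in> {1..n}" using permutes_in_image[OF \<pi>, of i] i assms by simp
    ultimately show "y \<in> {1..m}" using permutes_eq_card_le[OF \<pi>, of i] i assms by simp
  qed
  then show "\<pi> ` {1..m} = {1..m}"
    by (intro card_subset_eq) (auto simp: card_image permutes_inj_on[OF \<pi>])
qed

text \<open>Once \<open>{1..m}\<close> is invariant, both \<open>\<sigma> m = m\<close> and
  \<open>pnt \<sigma> m = m\<close> say that position \<open>m\<close> carries the largest of the
  first \<open>m\<close> values.\<close>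

lemma strong_fixed_point_iff_pnt:
  assumes \<sigma>: "\<sigma> permutes {1..n}" and m: "m \<in> {1..n}"
  shows "strong_fixed_point \<sigma> m \<longleftrightarrow> pnt \<sigma> m = m \<and> (\<forall>j\<in>{m<..n}. m < pnt \<sigma> j)"
proof -
  have "\<sigma> m = m \<longleftrightarrow> pnt \<sigma> m = m" if im: "\<sigma> ` {1..m} = {1..m}"
  proof
    assume "\<sigma> m = m"
    moreover have "\<sigma> i \<le> m" if "i \<in> {1..<m}" for i using im that by force
    moreover have "\<sigma> i \<noteq> \<sigma> m" if "i \<in> {1..<m}" for i
      using permutes_inj[OF \<sigma>] that by (auto dest: injD)
    ultimately have "{i \<in> {1..<m}. \<sigma> i < \<sigma> m} = {1..<m}" by force
    then show "pnt \<sigma> m = m" using m by (simp add: pnt_def)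
  next
    assume "pnt \<sigma> m = m"
    then have "card {i \<in> {1..<m}. \<sigma> i < \<sigma> m} = card {1..<m}" using m by (simp add: pnt_def)
    then have "{i \<in> {1..<m}. \<sigma> i < \<sigma> m} = {1..<m}" by (intro card_subset_eq) auto
    then have less: "\<sigma> i < \<sigma> m" if "i \<in> {1..<m}" for i using that by blast
    have "m \<in> \<sigma> ` {1..m}" using im m by simp
    then obtain i where "i \<in> {1..m}" "\<sigma> i = m" by auto
    then have "m \<le> \<sigma> m" using less[of i] by (cases "i = m") auto
    moreover have "\<sigma> m \<in> {1..m}" using im m by fastforce
    ultimately show "\<sigma> m = m" by simp
  qed
  then show ?thesis
    using image_initial_segment_iff_pnt[OF \<sigma>, of m] m by (auto simp: strong_fixed_point_def)
qed


section \<open>Cuts of a word\<close>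

text \<open>
  The factorization is greedy, so it makes sense for every word: \<open>last_cut v m\<close> is the largest
  cut that is at most \<open>m\<close>, and \<open>m > 1\<close> is a cut iff \<open>v m \<le> last_cut v (m - 1)\<close>. Position 1 is
  always a cut; the value 1 at 0 is a convention that makes the recursion uniform.
\<close>

fun last_cut :: "(nat \<Rightarrow> nat) \<Rightarrow> nat \<Rightarrow> nat" where
  "last_cut v 0 = 1"
| "last_cut v (Suc m) = (if v (Suc m) \<le> last_cut v m then Suc m else last_cut v m)"

lemma last_cut_cong:
  "(\<And>j. j \<in> {1..m} \<Longrightarrow> v j = u j) \<Longrightarrow> last_cut v m = last_cut u m"
  by (induction m) auto

lemma last_cut_range: "1 \<le> m \<Longrightarrow> last_cut v m \<in> {1..m}"
  by (induction m rule: dec_induct) auto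

lemma last_cut_eq_self_iff:
  assumes "2 \<le> j"
  shows "last_cut v j = j \<longleftrightarrow> v j \<le> last_cut v (j - 1)"
proof -
  from assms obtain m where "j = Suc m" "1 \<le> m" by (cases j) auto
  then show ?thesis using last_cut_range[of m v] by auto
qed

lemma last_cut_mono:
  assumes "1 \<le> a" "a \<le> b"
  shows "last_cut v a \<le> last_cut v b"
  using assms(2)
proof (induction b rule: dec_induct)
  case (step b)
  have "last_cut v b \<in> {1..b}" using last_cut_range step assms by auto
  with step show ?case by auto
qed simp

lemma last_cut_idem: "1 \<le> m \<Longrightarrow> last_cut v (last_cut v m) = last_cut v m"
  by (induction m rule: dec_induct) auto

text \<open>A factor stays open exactly while its letters exceed the cut before it. For
  \<open>m = n\<close> this says that an unfinished factor exhibits an invariant initial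
  segment.\<close>

lemma less_after_last_cut:
  assumes "1 \<le> m" "last_cut v m < x" "x \<le> m"
  shows "last_cut v m < v x"
  using assms
proof (induction m rule: dec_induct)
  case (step m)
  show ?case
  proof (cases "v (Suc m) \<le> last_cut v m")
    case False
    with step show ?thesis by (cases "x = Suc m") auto
  qed (use step in auto)
qed (auto split: if_splits)

text \<open>A factor opened after a cut at most \<open>m\<close> can only be closed by a letter at
  most that cut, and no such letter occurs after \<open>m\<close>.\<close>

lemma last_cut_le:
  assumes "1 \<le> m" "m \<le> b" "\<And>x. m < x \<Longrightarrow> x \<le> b \<Longrightarrow> m < v x"
  shows "last_cut v b \<le> m"
  using assms(2,3)
proof (induction b rule: dec_induct)
  case base
  show ?case using last_cut_range[of m v] assms(1) by simp
next
  case (step b)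
  then have "last_cut v b \<le> m" "m < v (Suc b)" by auto
  then show ?case by simp
qed

section \<open>Kernel factorizations as lists of greedy cuts\<close>

lemma kernel_factorization_snoc:
  assumes "js \<noteq> []"
  shows "kernel_factorization n v (js @ [n]) \<longleftrightarrow>
    kernel_factorization (last js) v js \<and> elementary_kernel_factor v (last js + 1) n"
proof -
  have "x \<le> last js" if "sorted_wrt (<) js" "x \<in> set js" for x
    using that assms by (induction js) (auto simp: less_imp_le)
  then have "\<forall>x\<in>set js. x < n" if "sorted_wrt (<) js" "elementary_kernel_factor v (last js + 1) n"
    using that by (fastforce simp: elementary_kernel_factor_def)
  then show ?thesis using assms
    by (auto simp: kernel_factorization_def successively_append_iff sorted_wrt_append)
qed

lemma kernel_factorization_exists:
  assumes "1 \<le> m" "last_cut v m = m"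
  shows "\<exists>js. kernel_factorization m v js"
  using assms
proof (induction m rule: less_induct)
  case (less m)
  show ?case
  proof (cases "m = 1")
    case True
    then have "kernel_factorization m v [1]" by (simp add: kernel_factorization_def)
    then show ?thesis by blast
  next
    case False
    \<comment> \<open>The last factor begins right after the greatest cut below \<open>m\<close>;
      removing it leaves a shorter word to factorize.\<close>
    define a where "a = last_cut v (m - 1)"
    have m: "2 \<le> m" using less.prems False by simp
    have a: "a \<in> {1..m - 1}" using last_cut_range[of "m - 1" v] m by (simp add: a_def)
    then have "a < m" using m by auto
    moreover have "last_cut v a = a" using last_cut_idem[of "m - 1" v] m by (simp add: a_def)
    ultimately obtain js where js: "kernel_factorization a v js" using less.IH[of a] a by auto
    have "v m \<le> a" using last_cut_eq_self_iff[OF m] less.prems by (simp add: a_def)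
    moreover have "a < v x" if "x \<in> {a + 1..<m}" for x
      using less_after_last_cut[of "m - 1" v x] that m unfolding a_def by force
    ultimately have "elementary_kernel_factor v (a + 1) m"
      using a \<open>a < m\<close> by (simp add: elementary_kernel_factor_def Suc_le_eq)
    moreover have "js \<noteq> []" "last js = a" using js by (auto simp: kernel_factorization_def)
    ultimately have "kernel_factorization m v (js @ [m])"
      using js kernel_factorization_snoc by simp
    then show ?thesis by blast
  qed
qed

text \<open>Gives uniqueness, since the right side does not mention \<open>js\<close>. Within a
  factor following the cut \<open>a\<close> all letters but the last exceed \<open>a\<close>, so the
  greedy procedure stays at \<open>a\<close> until the factor ends.\<close>

lemma set_kernel_factorization:
  assumes "kernel_factorization m v js"
  shows "set js = {j \<in> {1..m}. last_cut v j = j}"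
  using assms
proof (induction js arbitrary: m rule: rev_induct)
  case Nil
  then show ?case by (simp add: kernel_factorization_def)
next
  case (snoc x js)
  have [simp]: "x = m" using snoc.prems by (simp add: kernel_factorization_def)
  show ?case
  proof (cases "js = []")
    case True
    then have "m = 1" using snoc.prems by (simp add: kernel_factorization_def)
    then show ?thesis using True by auto
  next
    case False
    define a where "a = last js"
    have js: "kernel_factorization a v js" and fac: "elementary_kernel_factor v (a + 1) m"
      using snoc.prems kernel_factorization_snoc[OF False] by (auto simp: a_def)
    have "a \<in> set js" using False by (simp add: a_def)
    then have a: "1 \<le> a" "last_cut v a = a" using snoc.IH[OF js] by auto
    have between: "last_cut v x = a" if "a \<le> x" "x < m" for x
      using that
    proof (induction x rule: dec_induct)
      case (step x)
      have "a < v (Suc x)" using fac step by (force simp: elementary_kernel_factor_def)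
      with step show ?case by simp
    qed (simp add: a)
    have "a < m" "v m \<le> a" using fac by (auto simp: elementary_kernel_factor_def)
    then have "last_cut v m = m"
      using last_cut_eq_self_iff[of m v] between[of "m - 1"] a by simp
    have "j \<le> a" if "j < m" "last_cut v j = j" for j using between[of j] that by force
    then have "{j \<in> {1..m}. last_cut v j = j} = insert m {j \<in> {1..a}. last_cut v j = j}"
      using \<open>a < m\<close> \<open>last_cut v m = m\<close> a by (auto simp: le_less)
    then show ?thesis using snoc.IH[OF js] by simp
  qed
qed

text \<open>Strictly sorted lists with the same elements coincide, which evaluates
  \<open>THE\<close>. The head 1 ends no factor, hence the range \<open>{2..n}\<close>.\<close>

lemma set_tl_the_kernel_factorization:
  assumes "1 \<le> n" "last_cut v n = n"
  shows "set (tl (THE js. kernel_factorization n v js)) = {j \<in> {2..n}. v j \<le> last_cut v (j - 1)}"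
proof -
  obtain js where js: "kernel_factorization n v js" using kernel_factorization_exists assms by blast
  have "(THE js. kernel_factorization n v js) = js"
  proof (rule the_equality, rule js)
    fix ks assume ks: "kernel_factorization n v ks"
    then show "ks = js" using js set_kernel_factorization[OF js] set_kernel_factorization[OF ks]
      by (intro strict_sorted_equal) (auto simp: kernel_factorization_def)
  qed
  moreover obtain ks where ks: "js = 1 # ks" "1 \<notin> set ks"
    using js by (cases js) (auto simp: kernel_factorization_def)
  then have "set (tl js) = set js - {1}" by auto
  moreover have "set js - {1} = {j \<in> {2..n}. last_cut v j = j}"
  proof -
    have "{1..n} - {1} = {2..n}" by auto
    then show ?thesis unfolding set_kernel_factorization[OF js] by blast
  qed
  moreover have "\<dots> = {j \<in> {2..n}. v j \<le> last_cut v (j - 1)}"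
    by (simp add: last_cut_eq_self_iff cong: conj_cong)
  ultimately show ?thesis by simp
qed

text \<open>If the last cut lies below \<open>n\<close>, it is itself the length of an invariant
  segment. Conversely, an invariant segment of length \<open>m < n\<close> confines all cuts to
  positions up to \<open>m\<close>.\<close>

lemma connected_perm_iff_last_cut:
  assumes \<pi>: "\<pi> permutes {1..n}" and "1 \<le> n"
  shows "connected_perm n \<pi> \<longleftrightarrow> last_cut (pnt \<pi>) n = n"
proof -
  have "connected_perm n \<pi> \<longleftrightarrow> \<not> (\<exists>m. 1 \<le> m \<and> m < n \<and> (\<forall>j\<in>{m<..n}. m < pnt \<pi> j))"
    using image_initial_segment_iff_pnt[OF \<pi>] by (auto simp: connected_perm_def)
  also have "\<dots> \<longleftrightarrow> last_cut (pnt \<pi>) n = n"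
  proof
    let ?m = "last_cut (pnt \<pi>) n"
    assume "\<not> (\<exists>m. 1 \<le> m \<and> m < n \<and> (\<forall>j\<in>{m<..n}. m < pnt \<pi> j))"
    moreover have "\<forall>j\<in>{?m<..n}. ?m < pnt \<pi> j"
      using less_after_last_cut[OF \<open>1 \<le> n\<close>, of "pnt \<pi>"] by simp
    moreover have "?m \<in> {1..n}" using last_cut_range assms(2) by blast
    ultimately show "?m = n" by (metis atLeastAtMost_iff le_neq_implies_less)
  next
    assume eq: "last_cut (pnt \<pi>) n = n"
    show "\<not> (\<exists>m. 1 \<le> m \<and> m < n \<and> (\<forall>j\<in>{m<..n}. m < pnt \<pi> j))"
      using last_cut_le[of _ n "pnt \<pi>"] eq by fastforce
  qed
  finally show ?thesis .
qed

text \<open>Connectedness and the equation for the elevation, expressed on words without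
  \<open>THE\<close>. Position 1 is omitted because every table starts with 1.\<close>

definition elevates_to :: "nat \<Rightarrow> (nat \<Rightarrow> nat) \<Rightarrow> (nat \<Rightarrow> nat) \<Rightarrow> bool" where
  "elevates_to n v w \<longleftrightarrow> last_cut v n = n \<and>
     (\<forall>j\<in>{2..n}. w j = (if v j \<le> last_cut v (j - 1) then j else v j))"

lemma elevates_to_cong:
  assumes "\<And>j. j \<in> {1..n} \<Longrightarrow> v j = u j"
  shows "elevates_to n v w \<longleftrightarrow> elevates_to n u w"
proof -
  have "last_cut v j = last_cut u j" if "j \<le> n" for j
    using that assms by (intro last_cut_cong) auto
  then show ?thesis using assms by (auto simp: elevates_to_def)
qed

lemma elevation_eq_iff:
  assumes \<pi>: "\<pi> permutes {1..n}" and \<sigma>: "\<sigma> permutes {1..n}" and "1 \<le> n"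
  shows "connected_perm n \<pi> \<and> elevation n \<pi> = \<sigma> \<longleftrightarrow> elevates_to n (pnt \<pi>) (pnt \<sigma>)"
proof (cases "last_cut (pnt \<pi>) n = n")
  case True
  have ep: "elevated_pnt n \<pi> j =
      (if 2 \<le> j \<and> pnt \<pi> j \<le> last_cut (pnt \<pi>) (j - 1) then j else pnt \<pi> j)"
    if "j \<in> {1..n}" for j
    using that set_tl_the_kernel_factorization[OF \<open>1 \<le> n\<close> True] by (auto simp: elevated_pnt_def)
  \<comment> \<open>Raising a letter at \<open>j\<close> to \<open>j\<close> keeps it in
    \<open>{1..j}\<close>, so the elevated word is again a table and \<open>elevation\<close> is
    well defined.\<close>
  have ex1: "\<exists>!\<sigma>. \<sigma> permutes {1..n} \<and> (\<forall>j\<in>{1..n}. pnt \<sigma> j = elevated_pnt n \<pi> j)"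
    using ep pnt_range by (intro ex1_permutes_pnt) auto
  have "elevation n \<pi> permutes {1..n} \<and>
      (\<forall>j\<in>{1..n}. pnt (elevation n \<pi>) j = elevated_pnt n \<pi> j)"
    unfolding elevation_def by (rule theI'[OF ex1])
  then have "elevation n \<pi> = \<sigma> \<longleftrightarrow> (\<forall>j\<in>{1..n}. pnt \<sigma> j = elevated_pnt n \<pi> j)"
    using ex1 \<sigma> by blast
  also have "{1..n} = insert 1 {2..n}" using \<open>1 \<le> n\<close> by auto
  also have "(\<forall>j\<in>insert 1 {2..n}. pnt \<sigma> j = elevated_pnt n \<pi> j) \<longleftrightarrow>
      elevates_to n (pnt \<pi>) (pnt \<sigma>)"
    using ep \<open>1 \<le> n\<close> True by (auto simp: elevates_to_def pnt_def)
  finally show ?thesis using True connected_perm_iff_last_cut[OF \<pi> \<open>1 \<le> n\<close>] by simp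
next
  case False
  then show ?thesis using connected_perm_iff_last_cut[OF \<pi> \<open>1 \<le> n\<close>] by (simp add: elevates_to_def)
qed


section \<open>Counting words with a given elevation\<close>

text \<open>Counterpart of \<open>last_cut\<close> for a prescribed set of cuts; the default 1
  stands for the cut at position 1, which the sets of inner cuts leave out.\<close>

fun last_in :: "nat set \<Rightarrow> nat \<Rightarrow> nat" where
  "last_in S 0 = 1"
| "last_in S (Suc m) = (if Suc m \<in> S then Suc m else last_in S m)"

lemma last_in_range: "last_in S m = 1 \<or> last_in S m \<in> S \<inter> {1..m}"
  by (induction m) auto

text \<open>Telescoping: each element of \<open>S\<close> is the predecessor of the next one, and
  the first has predecessor 1. The extra factor supplies the greatest element, and later comes from
  the letter at \<open>n\<close>.\<close>

lemma prod_last_in: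
  assumes "1 \<le> m"
  shows "(\<Prod>j\<in>S \<inter> {2..m}. last_in S (j - 1)) * last_in S m = \<Prod>(S \<inter> {2..m})"
  using assms
proof (induction m rule: dec_induct)
  case (step m)
  have "S \<inter> {2..Suc m} = (if Suc m \<in> S then insert (Suc m) (S \<inter> {2..m}) else S \<inter> {2..m})"
    using step.hyps by (auto simp: le_Suc_eq)
  then show ?case by (auto simp: algebra_simps simp flip: step.IH)
qed auto

text \<open>For a table \<open>w\<close> these are the strong fixed points strictly between 1 and
  \<open>n\<close>, by \<open>strong_fixed_point_iff_pnt\<close>.\<close>

definition strong_positions :: "nat \<Rightarrow> (nat \<Rightarrow> nat) \<Rightarrow> nat set" where
  "strong_positions n w = {s \<in> {2..<n}. w s = s \<and> (\<forall>j\<in>{s<..n}. s < w j)}"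

definition words_with_elevation :: "nat \<Rightarrow> (nat \<Rightarrow> nat) \<Rightarrow> (nat \<Rightarrow> nat) set" where
  "words_with_elevation n w = {v \<in> (\<Pi>\<^sub>E j\<in>{1..n}. {1..j}). elevates_to n v w}"

definition inner_cuts :: "nat \<Rightarrow> (nat \<Rightarrow> nat) \<Rightarrow> nat set" where
  "inner_cuts n v = {j \<in> {2..<n}. v j \<le> last_cut v (j - 1)}"

text \<open>At a position \<open>j\<close> after a cut \<open>s\<close>, the elevated letter is
  either \<open>j\<close> itself or a letter above the preceding cut, which is at least
  \<open>s\<close>.\<close>

lemma inner_cuts_subset_strong_positions:
  assumes "elevates_to n v w"
  shows "inner_cuts n v \<subseteq> strong_positions n w"
proof
  fix s assume "s \<in> inner_cuts n v"
  then have s: "s \<in> {2..<n}" "v s \<le> last_cut v (s - 1)" by (auto simp: inner_cuts_def)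
  then have cut: "last_cut v s = s" using last_cut_eq_self_iff by simp
  have w: "w j = (if v j \<le> last_cut v (j - 1) then j else v j)" if "j \<in> {2..n}" for j
    using assms that by (simp add: elevates_to_def)
  have "s < w j" if j: "j \<in> {s<..n}" for j
  proof -
    have "s \<le> last_cut v (j - 1)" using last_cut_mono[of s "j - 1" v] cut s j by auto
    then show ?thesis using w[of j] s j by auto
  qed
  then show "s \<in> strong_positions n w" using s w[of s] by (auto simp: strong_positions_def)
qed

text \<open>Fixing the cuts turns \<open>last_cut v\<close> into the known function
  \<open>last_in S\<close>. The conditions on different letters then become independent, and the
  words form a product set.\<close>

lemma words_with_elevation_and_cuts:
  assumes n: "2 \<le> n" and w: "w 1 = 1" "w n = n" "\<forall>j\<in>{2..n}. w j \<in> {2..j}"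
    and S: "S \<subseteq> strong_positions n w"
  shows "{v \<in> words_with_elevation n w. inner_cuts n v = S} =
    (\<Pi>\<^sub>E j\<in>{1..n}. if j \<in> insert n S then {1..last_in S (j - 1)} else {w j})"
    (is "?L = ?R")
proof (intro equalityI subsetI)
  fix v assume "v \<in> ?L"
  then have v: "v \<in> (\<Pi>\<^sub>E j\<in>{1..n}. {1..j})" and el: "elevates_to n v w"
    and cuts: "inner_cuts n v = S" by (auto simp: words_with_elevation_def)
  have last: "last_cut v j = last_in S j" if "j < n" for j
    using that
  proof (induction j)
    case (Suc j)
    then show ?case using cuts by (cases "j = 0") (auto simp: inner_cuts_def)
  qed simp
  have "v j \<in> (if j \<in> insert n S then {1..last_in S (j - 1)} else {w j})" if j: "j \<in> {1..n}" for j
  proof -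
    have vj: "v j \<in> {1..j}" using v j by auto
    consider "j = 1" | "j = n" | "j \<in> {2..<n}" using j n by force
    then show ?thesis
    proof cases
      case 1
      then show ?thesis using vj w n S by (auto simp: strong_positions_def)
    next
      case 2
      have "v n \<le> last_cut v (n - 1)" using el n last_cut_eq_self_iff by (simp add: elevates_to_def)
      then show ?thesis using 2 vj last[of "n - 1"] n by simp
    next
      case 3
      then have eq: "last_cut v (j - 1) = last_in S (j - 1)" by (intro last) auto
      then have "j \<in> S \<longleftrightarrow> v j \<le> last_in S (j - 1)" using 3 cuts by (auto simp: inner_cuts_def)
      moreover have "w j = (if v j \<le> last_in S (j - 1) then j else v j)"
        using el 3 eq by (simp add: elevates_to_def)
      ultimately show ?thesis using 3 vj by auto
    qed
  qed
  then show "v \<in> ?R" using v by (auto simp: PiE_iff)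
next
  fix v assume "v \<in> ?R"
  then have v: "v j \<in> (if j \<in> insert n S then {1..last_in S (j - 1)} else {w j})"
    if "j \<in> {1..n}" for j using that by blast
  have ext: "v \<in> extensional {1..n}" using \<open>v \<in> ?R\<close> by (simp add: PiE_iff)
  have cut_iff: "v j \<le> last_in S (j - 1) \<longleftrightarrow> j \<in> insert n S" if j: "j \<in> {2..n}" for j
  proof (cases "j \<in> insert n S")
    case True
    then show ?thesis using v[of j] j by simp
  next
    case False
    \<comment> \<open>An unchanged letter must not create a new cut. If the preceding cut is 1, this
      holds because \<open>w j\<close> is at least 2; otherwise because that cut is a strong
      position.\<close>
    have "last_in S (j - 1) < w j"
      using last_in_range[of S "j - 1"]
    proof
      assume "last_in S (j - 1) = 1"
      moreover have "w j \<in> {2..j}" using w j by blast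
      ultimately show ?thesis by simp
    next
      assume a: "last_in S (j - 1) \<in> S \<inter> {1..j - 1}"
      then have "last_in S (j - 1) \<in> strong_positions n w" using S by blast
      moreover have "j \<in> {last_in S (j - 1)<..n}" using a j by auto
      ultimately show ?thesis unfolding strong_positions_def by blast
    qed
    then show ?thesis using False v[of j] j by simp
  qed
  have last: "last_cut v j = last_in S j" if "j < n" for j
    using that
  proof (induction j)
    case (Suc j)
    then show ?case using cut_iff[of "Suc j"] by (cases "j = 0") auto
  qed simp
  have cut_iff': "v j \<le> last_cut v (j - 1) \<longleftrightarrow> j \<in> insert n S" if "j \<in> {2..n}" for j
  proof -
    have "last_cut v (j - 1) = last_in S (j - 1)" using that by (intro last) auto
    then show ?thesis using cut_iff[OF that] by simp
  qed
  have wS: "w j = j" if "j \<in> insert n S" for j using that S w by (auto simp: strong_positions_def)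
  have "v j \<in> {1..j}" if j: "j \<in> {1..n}" for j
  proof (cases "j \<in> insert n S")
    case True
    then show ?thesis using v[OF j] last_in_range[of S "j - 1"] j by auto
  next
    case False
    moreover have "w j \<in> {1..j}"
    proof (cases "j = 1")
      case False
      then have "j \<in> {2..n}" using j by auto
      then have "w j \<in> {2..j}" using w by blast
      then show ?thesis by auto
    qed (use w in simp)
    ultimately show ?thesis using v[OF j] by simp
  qed
  moreover have "elevates_to n v w"
    unfolding elevates_to_def
  proof (intro conjI ballI)
    show "last_cut v n = n" using last_cut_eq_self_iff[OF n] cut_iff'[of n] n by simp
    fix j assume j: "j \<in> {2..n}"
    then show "w j = (if v j \<le> last_cut v (j - 1) then j else v j)"
      using cut_iff'[OF j] wS v[of j] by (cases "j \<in> insert n S") auto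
  qed
  moreover have "inner_cuts n v = S"
    using cut_iff' S by (auto simp: inner_cuts_def strong_positions_def)
  ultimately show "v \<in> ?L" using ext by (auto simp: words_with_elevation_def PiE_iff)
qed

lemma card_words_with_elevation:
  assumes n: "2 \<le> n" and w: "w 1 = 1" "w n = n" "\<forall>j\<in>{2..n}. w j \<in> {2..j}"
  shows "card (words_with_elevation n w) = (\<Prod>s\<in>strong_positions n w. s + 1)"
proof -
  let ?F = "strong_positions n w"
  let ?V = "\<lambda>S. {v \<in> words_with_elevation n w. inner_cuts n v = S}"
  have fin: "finite ?F" by (simp add: strong_positions_def)
  have card_V: "card (?V S) = \<Prod>S" and fin_V: "finite (?V S)" if S: "S \<in> Pow ?F" for S
  proof -
    have S': "S \<subseteq> {2..<n}" using S by (auto simp: strong_positions_def)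
    have V: "?V S = (\<Pi>\<^sub>E j\<in>{1..n}. if j \<in> insert n S then {1..last_in S (j - 1)} else {w j})"
      using S by (intro words_with_elevation_and_cuts[OF n w]) auto
    then show "finite (?V S)" by (simp add: finite_PiE)
    have "card (?V S) = (\<Prod>j\<in>{1..n}. if j \<in> insert n S then last_in S (j - 1) else 1)"
      unfolding V by (subst card_PiE) (auto intro!: prod.cong)
    \<comment> \<open>Letters away from the cuts are forced and contribute the factor 1.\<close>
    also have "\<dots> = (\<Prod>j\<in>insert n S. last_in S (j - 1))"
      using S' n by (intro prod.mono_neutral_cong_right) auto
    also have "\<dots> = (\<Prod>j\<in>S. last_in S (j - 1)) * last_in S (n - 1)"
      using S' finite_subset[OF S'] by (subst prod.insert) (auto simp: mult.commute)
    also have "\<dots> = \<Prod>S"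
    proof -
      have "S \<inter> {2..n - 1} = S" using S' by force
      then show ?thesis using prod_last_in[of "n - 1" S] n by simp
    qed
    finally show "card (?V S) = \<Prod>S" .
  qed
  have "words_with_elevation n w = (\<Union>S\<in>Pow ?F. ?V S)"
    using inner_cuts_subset_strong_positions by (fastforce simp: words_with_elevation_def)
  then have "card (words_with_elevation n w) = card (\<Union>S\<in>Pow ?F. ?V S)" by simp
  also have "\<dots> = (\<Sum>S\<in>Pow ?F. card (?V S))"
    using fin fin_V by (intro card_UN_disjoint) auto
  also have "\<dots> = (\<Sum>S\<in>Pow ?F. \<Prod>S)" using card_V by (intro sum.cong) auto
  \<comment> \<open>Expanding the product of the binomials \<open>s + 1\<close> yields one summand
    for each subset of \<open>?F\<close>.\<close>
  also have "\<dots> = (\<Prod>s\<in>?F. s + 1)" using prod_add[OF fin, of "\<lambda>s. s" "\<lambda>_. 1"] by simp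
  finally show ?thesis .
qed

section \<open>Transfer of the count from words to permutations\<close>

theorem theorem4p14:
  fixes n k :: nat and \<sigma> i :: "nat \<Rightarrow> nat"
  assumes "\<sigma> permutes {1..n}"
    and "\<sigma> 1 = 1"
    and "\<sigma> n = n"
    and "strict_mono_on {0..k+1} i"
    and "i 0 = 1"
    and "i (k+1) = n"
    and "i ` {0..k+1} = {m \<in> {1..n}. strong_fixed_point \<sigma> m}"
  shows "card {\<pi>. \<pi> permutes {1..n} \<and> connected_perm n \<pi> \<and> elevation n \<pi> = \<sigma>}
           = (\<Prod>t=1..k. i t + 1)"
proof -
  note \<sigma> = assms(1)
  let ?w = "pnt \<sigma>"
  have mono: "i s < i t" if "s < t" "t \<le> k + 1" for s t
    using strict_mono_onD[OF assms(4), of s t] that by simp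
  have n: "2 \<le> n" using mono[of 0 "k + 1"] assms by simp
  have strong: "s \<in> i ` {0..k+1} \<longleftrightarrow> ?w s = s \<and> (\<forall>j\<in>{s<..n}. s < ?w j)" if "s \<in> {1..n}" for s
    using assms(7) strong_fixed_point_iff_pnt[OF \<sigma> that] that by auto
  have "1 \<in> i ` {0..k+1}" "n \<in> i ` {0..k+1}" using assms(5,6) by (force intro: rev_image_eqI)+
  \<comment> \<open>That 1 is a strong fixed point makes every later letter exceed 1; that
    \<open>n\<close> is one makes the last letter \<open>n\<close>.\<close>
  then have w: "?w 1 = 1" "?w n = n" "\<forall>j\<in>{2..n}. ?w j \<in> {2..j}"
    using strong[of 1] strong[of n] n pnt_range[of _ \<sigma>] by (auto simp: Suc_le_eq numeral_2_eq_2)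
  have "strong_positions n ?w = i ` {0..k+1} \<inter> {2..<n}"
  proof (rule set_eqI)
    fix s
    show "s \<in> strong_positions n ?w \<longleftrightarrow> s \<in> i ` {0..k+1} \<inter> {2..<n}"
      using strong[of s] by (cases "s \<in> {2..<n}") (auto simp: strong_positions_def)
  qed
  \<comment> \<open>Discarding the values 1 and \<open>n\<close> discards exactly the indices 0 and
    \<open>k + 1\<close>, by strict monotonicity.\<close>
  also have "\<dots> = i ` {1..k}"
  proof -
    have "1 < i t \<and> i t < n" if "t \<in> {1..k}" for t
      using mono[of 0 t] mono[of t "k + 1"] assms(5,6) that by auto
    moreover have "{0..k+1} = insert 0 (insert (k+1) {1..k})" by auto
    ultimately show ?thesis using assms(5,6) by force
  qed
  finally have F: "strong_positions n ?w = i ` {1..k}" .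
  have inj: "inj_on i {1..k}"
    using strict_mono_on_imp_inj_on[OF assms(4)] by (rule inj_on_subset) auto
  let ?f = "\<lambda>\<pi>. restrict (pnt \<pi>) {1..n}"
  let ?P = "{\<pi>. \<pi> permutes {1..n} \<and> connected_perm n \<pi> \<and> elevation n \<pi> = \<sigma>}"
  have el: "elevates_to n (?f \<pi>) ?w \<longleftrightarrow> connected_perm n \<pi> \<and> elevation n \<pi> = \<sigma>"
    if "\<pi> permutes {1..n}" for \<pi>
    using elevation_eq_iff[OF that \<sigma>] elevates_to_cong[of n "?f \<pi>" "pnt \<pi>" ?w] n by simp
  have "bij_betw ?f ?P (words_with_elevation n ?w)"
  proof (rule bij_betw_subset[OF bij_betw_pnt[of n]])
    show "?f ` ?P = words_with_elevation n ?w"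
    proof (intro equalityI subsetI)
      fix v assume "v \<in> words_with_elevation n ?w"
      then have v: "v \<in> (\<Pi>\<^sub>E j\<in>{1..n}. {1..j})" "elevates_to n v ?w"
        by (auto simp: words_with_elevation_def)
      then have "v \<in> ?f ` {\<pi>. \<pi> permutes {1..n}}"
        using bij_betw_imp_surj_on[OF bij_betw_pnt[of n]] by simp
      then obtain \<pi> where "\<pi> permutes {1..n}" "v = ?f \<pi>" by blast
      then show "v \<in> ?f ` ?P" using el v by blast
    next
      fix v assume "v \<in> ?f ` ?P"
      then obtain \<pi> where "\<pi> \<in> ?P" "v = ?f \<pi>" by blast
      then show "v \<in> words_with_elevation n ?w"
        using el bij_betw_apply[OF bij_betw_pnt[of n], of \<pi>] by (simp add: words_with_elevation_def)
    qed
  qed auto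
  then have "card ?P = card (words_with_elevation n ?w)" by (rule bij_betw_same_card)
  also have "\<dots> = (\<Prod>s\<in>i ` {1..k}. s + 1)" using card_words_with_elevation[OF n w] F by simp
  also have "\<dots> = (\<Prod>t=1..k. i t + 1)" using inj by (simp add: prod.reindex)
  finally show ?thesis .
qed

end
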